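(* Let $G$ be a locally compact group, $K$ a compact subgroup of $G$, $U$ a $K$-bi-invariant symmetric neighbourhood of the identity in $G$, and $V$ a $K$-bi-invariant symmetric subset of $G$. Then $$\mathcal{C}_{G/K}(U,V)=\mathcal{C}_{G}^{K}(U,V).$$
   Context: $\lambda_G$ is a (left) Haar measure on $G$; $\lambda_K$ is the Haar measure on $K$ with $\lambda_K(K)=1$; $\mu$ is the $G$-invariant Radon measure on $G/K$ satisfying $\int_G f\,d\lambda_G=\int_{G/K}\int_K f(gk)\,d\lambda_K(k)\,d\mu(gK)$ for all $f\in C_c(G)$, where $C_c(G)$ is the set of continuous compactly supported complex-valued functions on $G$. A subset $A\subset G$ is $K$-bi-invariant if $KAK=A$, and symmetric if $A^{-1}=A$. A function $\varphi$ on $G$ is $K$-bi-invariant if $\varphi(kgk')=\varphi(g)$ for all $g\in G$, $k,k'\in K$. It is positive definite if $\sum_{i,j=1}^n c_i\overline{c_j}\varphi(g_i^{-1}g_j)\ge 0$ for all $n\in\mathbb{N}$, $c_i\in\mathbb{C}$, $g_i\in G$. For real-valued $\varphi$ write $\varphi_+=\max\{\varphi,0\}$, $\varphi_-=\max\{-\varphi,0\}$, and let $\operatorname{supp}$ denote the closure of the set where a function on $G$ is nonzero. A kernel on $G/K$ is a function $\Phi:G/K\times G/K\to\mathbb{C}$; it is $G$-invariant if $\Phi(gxK,gyK)=\Phi(xK,yK)$ for all $g,x,y\in G$, and positive definite if $\sum_{i,j=1}^n\Phi(x_iK,x_jK)a_i\overline{a_j}\ge0$ for all $n\in\mathbb{N}$,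 $a_i\in\mathbb{C}$, $x_i\in G$. For a real-valued kernel, $\Phi_+=\max\{\Phi,0\}$ and $\Phi_-=\max\{-\Phi,0\}$. For a $G$-invariant kernel $\Phi$, $\operatorname{supp}\Phi:=\overline{\{x\in G:\Phi(gK,xK)\neq 0\}}\subset G$ with base point $g=e$. $\mathcal{F}_{G/K}(U,V)$ is the set of continuous positive definite $G$-invariant kernels $\Phi:G/K\times G/K\to\mathbb{R}$ with $\Phi(gK,gK)=1$ for all $g\in G$, $\operatorname{supp}\Phi_+\subset U$ and $\operatorname{supp}\Phi_-\subset V$, and $$\mathcal{C}_{G/K}(U,V):=\sup_{\Phi\in\mathcal{F}_{G/K}(U,V)}\int_{G/K}\Phi(xK,yK)\,d\mu(yK),$$ where $x\in G$ is arbitrary (the integral does not depend on $x$). $\mathcal{F}_G^K(U,V)$ is the set of continuous positive definite $K$-bi-invariant functions $\varphi:G\to\mathbb{R}$ with $\varphi(e)=1$, $\operatorname{supp}\varphi_+\subset U$ and $\operatorname{supp}\varphi_-\subset V$, and $$\mathcal{C}_G^K(U,V):=\sup_{\varphi\in\mathcal{F}_G^K(U,V)}\int_G\varphi(g)\,d\lambda_G(g).$$ *)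

theory Defs
  imports "HOL-Analysis.Analysis" "HOL-Algebra.Left_Coset"
begin

section \<open>Locally compact groups and their coset spaces\<close>

locale topological_group = group G for G :: "('a, 'b) monoid_scheme" (structure) +
  fixes T :: "'a topology"
  assumes topspace_eq: "topspace T = carrier G"
    and continuous_mult: "continuous_map (prod_topology T T) T (\<lambda>(x, y). x \<otimes> y)"
    and continuous_inv: "continuous_map T T (\<lambda>x. inv x)"

text \<open>As usual, locally compact groups are Hausdorff.\<close>

locale locally_compact_group = topological_group +
  assumes Hausdorff: "Hausdorff_space T"
    and locally_compact: "locally_compact_space T"

definition coset_topology :: "('a, 'b) monoid_scheme \<Rightarrow> 'a topology \<Rightarrow> 'a set \<Rightarrow> 'a set topology" where
  "coset_topology G T K =
     topology (\<lambda>S. S \<subseteq> lcosets\<^bsub>G\<^esub> K \<and> openin T {g \<in> topspace T. g <#\<^bsub>G\<^esub> K \<in> S})"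

lemma openin_coset_topology:
  "openin (coset_topology G T K) S \<longleftrightarrow>
     S \<subseteq> lcosets\<^bsub>G\<^esub> K \<and> openin T {g \<in> topspace T. g <#\<^bsub>G\<^esub> K \<in> S}"
proof -
  have "istopology (\<lambda>S. S \<subseteq> lcosets\<^bsub>G\<^esub> K \<and> openin T {g \<in> topspace T. g <#\<^bsub>G\<^esub> K \<in> S})"
    unfolding istopology_def
  proof (intro conjI allI impI)
    fix A B
    assume "A \<subseteq> lcosets\<^bsub>G\<^esub> K \<and> openin T {g \<in> topspace T. g <#\<^bsub>G\<^esub> K \<in> A}"
      and "B \<subseteq> lcosets\<^bsub>G\<^esub> K \<and> openin T {g \<in> topspace T. g <#\<^bsub>G\<^esub> K \<in> B}"
    moreover have "{g \<in> topspace T. g <#\<^bsub>G\<^esub> K \<in> A \<inter> B} =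
        {g \<in> topspace T. g <#\<^bsub>G\<^esub> K \<in> A} \<inter> {g \<in> topspace T. g <#\<^bsub>G\<^esub> K \<in> B}"
      by auto
    ultimately show "A \<inter> B \<subseteq> lcosets\<^bsub>G\<^esub> K"
      and "openin T {g \<in> topspace T. g <#\<^bsub>G\<^esub> K \<in> A \<inter> B}"
      by auto
  next
    fix \<S>
    assume *: "\<forall>S\<in>\<S>. S \<subseteq> lcosets\<^bsub>G\<^esub> K \<and> openin T {g \<in> topspace T. g <#\<^bsub>G\<^esub> K \<in> S}"
    then show "\<Union>\<S> \<subseteq> lcosets\<^bsub>G\<^esub> K"
      by blast
    have "{g \<in> topspace T. g <#\<^bsub>G\<^esub> K \<in> \<Union>\<S>} = (\<Union>S\<in>\<S>. {g \<in> topspace T. g <#\<^bsub>G\<^esub> K \<in> S})"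
      by auto
    then show "openin T {g \<in> topspace T. g <#\<^bsub>G\<^esub> K \<in> \<Union>\<S>}"
      using * by auto
  qed
  then show ?thesis
    by (simp add: coset_topology_def)
qed

lemma (in topological_group) topspace_coset_topology:
  "topspace (coset_topology G T K) = lcosets K"
proof (rule antisym)
  show "topspace (coset_topology G T K) \<subseteq> lcosets K"
    using openin_coset_topology[of G T K "topspace (coset_topology G T K)"] by simp
  have "{g \<in> topspace T. g <# K \<in> lcosets K} = topspace T"
    by (auto simp: LCOSETS_def topspace_eq)
  then have "openin (coset_topology G T K) (lcosets K)"
    by (simp add: openin_coset_topology)
  then show "lcosets K \<subseteq> topspace (coset_topology G T K)"
    by (rule openin_subset)
qed

lemma (in topological_group) quotient_map_coset_topology:
  "quotient_map T (coset_topology G T K) (\<lambda>g. g <# K)"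
  by (auto simp: quotient_map_def topspace_coset_topology openin_coset_topology
      LCOSETS_def topspace_eq)


section \<open>Radon and Haar measures\<close>

definition borel_of :: "'a topology \<Rightarrow> 'a measure" where
  "borel_of X = sigma (topspace X) {S. openin X S}"

definition radon_measure :: "'a topology \<Rightarrow> 'a measure \<Rightarrow> bool" where
  "radon_measure X M \<longleftrightarrow>
     space M = topspace X \<and> sets M = sets (borel_of X) \<and>
     (\<forall>C. compactin X C \<and> C \<in> sets M \<longrightarrow> emeasure M C < \<infinity>) \<and>
     (\<forall>A\<in>sets M. emeasure M A = (INF W\<in>{W. openin X W \<and> A \<subseteq> W}. emeasure M W)) \<and>
     (\<forall>W. openin X W \<longrightarrow>
        emeasure M W = (SUP C\<in>{C. compactin X C \<and> C \<in> sets M \<and> C \<subseteq> W}. emeasure M C))"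

definition left_haar_measure :: "('a, 'b) monoid_scheme \<Rightarrow> 'a topology \<Rightarrow> 'a measure \<Rightarrow> bool" where
  "left_haar_measure G T M \<longleftrightarrow>
     radon_measure T M \<and> emeasure M (carrier G) \<noteq> 0 \<and>
     (\<forall>g\<in>carrier G. \<forall>A\<in>sets M. emeasure M (g <#\<^bsub>G\<^esub> A) = emeasure M A)"

definition normalized_haar_measure ::
    "('a, 'b) monoid_scheme \<Rightarrow> 'a topology \<Rightarrow> 'a set \<Rightarrow> 'a measure \<Rightarrow> bool" where
  "normalized_haar_measure G T K M \<longleftrightarrow>
     left_haar_measure (G\<lparr>carrier := K\<rparr>) (subtopology T K) M \<and> emeasure M K = 1"

definition Cc :: "'a topology \<Rightarrow> ('a \<Rightarrow> complex) set" where
  "Cc X = {f. continuous_map X euclidean f \<and> compactin X (X closure_of {x \<in> topspace X. f x \<noteq> 0})}"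

text \<open>In the last clause, the inner integral does not depend on the representative of the
  coset \<open>X\<close>, by left invariance of \<open>\<nu>\<^sub>K\<close>.\<close>

definition invariant_coset_measure ::
    "('a, 'b) monoid_scheme \<Rightarrow> 'a topology \<Rightarrow> 'a set \<Rightarrow> 'a measure \<Rightarrow> 'a measure \<Rightarrow> 'a set measure \<Rightarrow> bool"
  where
  "invariant_coset_measure G T K \<nu>\<^sub>G \<nu>\<^sub>K \<mu> \<longleftrightarrow>
     radon_measure (coset_topology G T K) \<mu> \<and>
     (\<forall>g\<in>carrier G. \<forall>A\<in>sets \<mu>. emeasure \<mu> ((\<lambda>X. g <#\<^bsub>G\<^esub> X) ` A) = emeasure \<mu> A) \<and>
     (\<forall>f\<in>Cc T. (LINT g|\<nu>\<^sub>G. f g) = (LINT X|\<mu>. (LINT k|\<nu>\<^sub>K. f ((SOME g. g \<in> X) \<otimes>\<^bsub>G\<^esub> k))))"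


section \<open>Extended integrals\<close>

text \<open>The integral of a real function is taken in \<open>[-\<infinity>, \<infinity>]\<close>; it exists unless the positive and the
  negative part both have infinite integral.  (\<open>ennreal\<close> maps negative numbers to 0.)\<close>

definition has_ext_integral :: "'a measure \<Rightarrow> ('a \<Rightarrow> real) \<Rightarrow> bool" where
  "has_ext_integral M f \<longleftrightarrow> f \<in> borel_measurable M \<and>
     ((\<integral>\<^sup>+x. ennreal (f x) \<partial>M) < \<infinity> \<or> (\<integral>\<^sup>+x. ennreal (- f x) \<partial>M) < \<infinity>)"

definition ext_integral :: "'a measure \<Rightarrow> ('a \<Rightarrow> real) \<Rightarrow> ereal" where
  "ext_integral M f =
     enn2ereal (\<integral>\<^sup>+x. ennreal (f x) \<partial>M) - enn2ereal (\<integral>\<^sup>+x. ennreal (- f x) \<partial>M)"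


section \<open>Bi-invariant functions and the extremal problem on the group\<close>

definition bi_invariant_set :: "('a, 'b) monoid_scheme \<Rightarrow> 'a set \<Rightarrow> 'a set \<Rightarrow> bool" where
  "bi_invariant_set G K A \<longleftrightarrow> K <#>\<^bsub>G\<^esub> A <#>\<^bsub>G\<^esub> K = A"

definition symmetric_set :: "('a, 'b) monoid_scheme \<Rightarrow> 'a set \<Rightarrow> bool" where
  "symmetric_set G A \<longleftrightarrow> set_inv\<^bsub>G\<^esub> A = A"

definition bi_invariant_fun :: "('a, 'b) monoid_scheme \<Rightarrow> 'a set \<Rightarrow> ('a \<Rightarrow> 'c) \<Rightarrow> bool" where
  "bi_invariant_fun G K \<phi> \<longleftrightarrow>
     (\<forall>g\<in>carrier G. \<forall>k\<in>K. \<forall>k'\<in>K. \<phi> (k \<otimes>\<^bsub>G\<^esub> g \<otimes>\<^bsub>G\<^esub> k') = \<phi> g)"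

definition pos_def_fun :: "('a, 'b) monoid_scheme \<Rightarrow> ('a \<Rightarrow> complex) \<Rightarrow> bool" where
  "pos_def_fun G \<phi> \<longleftrightarrow>
     (\<forall>(n::nat) c g. (\<forall>i<n. g i \<in> carrier G) \<longrightarrow>
        (\<Sum>i<n. \<Sum>j<n. c i * cnj (c j) * \<phi> (inv\<^bsub>G\<^esub> (g i) \<otimes>\<^bsub>G\<^esub> g j)) \<in> \<real>\<^sub>\<ge>\<^sub>0)"

definition supp :: "'a topology \<Rightarrow> ('a \<Rightarrow> real) \<Rightarrow> 'a set" where
  "supp X f = X closure_of {x \<in> topspace X. f x \<noteq> 0}"

definition F_fun ::
    "('a, 'b) monoid_scheme \<Rightarrow> 'a topology \<Rightarrow> 'a set \<Rightarrow> 'a set \<Rightarrow> 'a set \<Rightarrow> ('a \<Rightarrow> real) set" where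
  "F_fun G T K U V = {\<phi>. continuous_map T euclideanreal \<phi> \<and>
     pos_def_fun G (\<lambda>g. complex_of_real (\<phi> g)) \<and> bi_invariant_fun G K \<phi> \<and> \<phi> \<one>\<^bsub>G\<^esub> = 1 \<and>
     supp T (\<lambda>g. max (\<phi> g) 0) \<subseteq> U \<and> supp T (\<lambda>g. max (- \<phi> g) 0) \<subseteq> V}"

definition C_fun ::
    "('a, 'b) monoid_scheme \<Rightarrow> 'a topology \<Rightarrow> 'a set \<Rightarrow> 'a measure \<Rightarrow> 'a set \<Rightarrow> 'a set \<Rightarrow> ereal" where
  "C_fun G T K \<nu>\<^sub>G U V =
     (SUP \<phi>\<in>{\<phi> \<in> F_fun G T K U V. has_ext_integral \<nu>\<^sub>G \<phi>}. ext_integral \<nu>\<^sub>G \<phi>)"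


section \<open>Invariant kernels and the extremal problem on the coset space\<close>

definition invariant_kernel ::
    "('a, 'b) monoid_scheme \<Rightarrow> 'a set \<Rightarrow> ('a set \<Rightarrow> 'a set \<Rightarrow> 'c) \<Rightarrow> bool" where
  "invariant_kernel G K \<Phi> \<longleftrightarrow>
     (\<forall>g\<in>carrier G. \<forall>x\<in>carrier G. \<forall>y\<in>carrier G.
        \<Phi> ((g \<otimes>\<^bsub>G\<^esub> x) <#\<^bsub>G\<^esub> K) ((g \<otimes>\<^bsub>G\<^esub> y) <#\<^bsub>G\<^esub> K) = \<Phi> (x <#\<^bsub>G\<^esub> K) (y <#\<^bsub>G\<^esub> K))"

definition pos_def_kernel ::
    "('a, 'b) monoid_scheme \<Rightarrow> 'a set \<Rightarrow> ('a set \<Rightarrow> 'a set \<Rightarrow> complex) \<Rightarrow> bool" where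
  "pos_def_kernel G K \<Phi> \<longleftrightarrow>
     (\<forall>(n::nat) a x. (\<forall>i<n. x i \<in> carrier G) \<longrightarrow>
        (\<Sum>i<n. \<Sum>j<n. \<Phi> (x i <#\<^bsub>G\<^esub> K) (x j <#\<^bsub>G\<^esub> K) * a i * cnj (a j)) \<in> \<real>\<^sub>\<ge>\<^sub>0)"

definition supp_kernel ::
    "('a, 'b) monoid_scheme \<Rightarrow> 'a topology \<Rightarrow> 'a set \<Rightarrow> ('a set \<Rightarrow> 'a set \<Rightarrow> real) \<Rightarrow> 'a set" where
  "supp_kernel G T K \<Phi> =
     T closure_of {x \<in> carrier G. \<Phi> (\<one>\<^bsub>G\<^esub> <#\<^bsub>G\<^esub> K) (x <#\<^bsub>G\<^esub> K) \<noteq> 0}"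

definition F_ker ::
    "('a, 'b) monoid_scheme \<Rightarrow> 'a topology \<Rightarrow> 'a set \<Rightarrow> 'a set \<Rightarrow> 'a set
      \<Rightarrow> ('a set \<Rightarrow> 'a set \<Rightarrow> real) set" where
  "F_ker G T K U V = {\<Phi>.
     continuous_map (prod_topology (coset_topology G T K) (coset_topology G T K)) euclideanreal
       (\<lambda>(X, Y). \<Phi> X Y) \<and>
     pos_def_kernel G K (\<lambda>X Y. complex_of_real (\<Phi> X Y)) \<and> invariant_kernel G K \<Phi> \<and>
     (\<forall>g\<in>carrier G. \<Phi> (g <#\<^bsub>G\<^esub> K) (g <#\<^bsub>G\<^esub> K) = 1) \<and>
     supp_kernel G T K (\<lambda>X Y. max (\<Phi> X Y) 0) \<subseteq> U \<and>
     supp_kernel G T K (\<lambda>X Y. max (- \<Phi> X Y) 0) \<subseteq> V}"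

text \<open>The point \<open>x\<close> at which the kernels are integrated is an explicit parameter.\<close>

definition C_ker ::
    "('a, 'b) monoid_scheme \<Rightarrow> 'a topology \<Rightarrow> 'a set \<Rightarrow> 'a set measure \<Rightarrow> 'a \<Rightarrow> 'a set \<Rightarrow> 'a set \<Rightarrow> ereal"
  where
  "C_ker G T K \<mu> x U V =
     (SUP \<Phi>\<in>{\<Phi> \<in> F_ker G T K U V. has_ext_integral \<mu> (\<Phi> (x <#\<^bsub>G\<^esub> K))}.
        ext_integral \<mu> (\<Phi> (x <#\<^bsub>G\<^esub> K)))"

end

theory Submission
  imports Defs
begin

text \<open>The projection \<open>p\<close> from \<open>G\<close> to \<open>G/K\<close> is a perfect map because \<open>K\<close> is compact, and Weil's formula for
  compactly supported functions constant on cosets identifies \<open>\<mu>\<close> with the image of the Haar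
  measure under \<open>p\<close>.  Since invariant kernels and bi-invariant functions correspond via
  \<open>\<Phi>(xK, yK) = \<phi>(x\<^sup>-\<^sup>1 y)\<close>, the integral of \<open>\<Phi>(xK, _)\<close> over \<open>G/K\<close> is that of a left translate of
  \<open>\<phi>\<close> over \<open>G\<close>, even when it is infinite.\<close>

section \<open>Radon measures and perfect maps\<close>

lemma space_borel_of [simp]: "space (borel_of X) = topspace X"
  by (simp add: borel_of_def space_measure_of_conv)

lemma sets_borel_of: "sets (borel_of X) = sigma_sets (topspace X) {S. openin X S}"
  unfolding borel_of_def by (rule sets_measure_of) (auto dest: openin_subset)

lemma openin_borel_of: "openin X S \<Longrightarrow> S \<in> sets (borel_of X)"
  by (auto simp: sets_borel_of)

lemma closedin_borel_of:
  assumes "closedin X S"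
  shows "S \<in> sets (borel_of X)"
proof -
  have "space (borel_of X) - (topspace X - S) \<in> sets (borel_of X)"
    using assms by (intro sets.compl_sets openin_borel_of) auto
  then show ?thesis
    using closedin_subset[OF assms] by (simp add: double_diff)
qed

lemma continuous_map_measurable:
  assumes "continuous_map X Y f" "space M = topspace X" "sets M = sets (borel_of X)"
    "space N = topspace Y" "sets N = sets (borel_of Y)"
  shows "f \<in> measurable M N"
proof (rule measurable_sigma_sets)
  show "sets N = sigma_sets (topspace Y) {S. openin Y S}"
    using assms by (simp add: sets_borel_of)
  show "f \<in> space M \<rightarrow> topspace Y"
    using assms continuous_map_funspace by fastforce
  show "f -` A \<inter> space M \<in> sets M" if "A \<in> {S. openin Y S}" for A
  proof -
    have "f -` A \<inter> space M = {x \<in> topspace X. f x \<in> A}"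
      using assms by auto
    also have "openin X \<dots>"
      using assms(1) that by (auto intro: openin_continuous_map_preimage)
    finally show ?thesis
      using assms(3) by (simp add: openin_borel_of)
  qed
qed (auto dest: openin_subset)

lemma continuous_map_borel_measurable:
  fixes f :: "'a \<Rightarrow> 'c::topological_space"
  assumes "continuous_map X euclidean f" "space M = topspace X" "sets M = sets (borel_of X)"
  shows "f \<in> borel_measurable M"
  \<comment> \<open>Take the target \<open>euclidean\<close>: \<open>borel\<close> and
    \<open>borel_of euclidean\<close> are both generated by the open sets.\<close>
  using assms by (intro continuous_map_measurable[where Y = euclidean])
    (auto simp: borel_of_def borel_def)

text \<open>Local compactness yields \<open>C \<subseteq> W \<subseteq> L\<close> with
  \<open>W\<close> open and \<open>L\<close> compact and closed. A function separating
  \<open>C\<close> from the complement of \<open>S \<inter> W\<close> then vanishes off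
  \<open>S\<close> and has its support inside \<open>L\<close>.\<close>

lemma Urysohn_compact_support:
  assumes "locally_compact_space X" "regular_space X" "compactin X C" "openin X S" "C \<subseteq> S"
  obtains f where "continuous_map X euclideanreal f" "\<And>x. x \<in> topspace X \<Longrightarrow> 0 \<le> f x \<and> f x \<le> 1"
    "\<And>x. x \<in> C \<Longrightarrow> f x = 1" "\<And>x. x \<in> topspace X - S \<Longrightarrow> f x = 0"
    "compactin X (X closure_of {x \<in> topspace X. f x \<noteq> 0})"
proof -
  obtain W L where W: "openin X W" "compactin X L" "closedin X L" "C \<subseteq> W" "W \<subseteq> L"
    using assms(1-3) locally_compact_space_compact_closed_compact[of X] by blast
  have "completely_regular_space X"
    using assms locally_compact_regular_imp_completely_regular_space by blast
  moreover have "closedin X (topspace X - S \<inter> W)"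
    using assms(4) W(1) by blast
  ultimately obtain f where f: "continuous_map X (top_of_set {0..1::real}) f"
      "f ` (topspace X - S \<inter> W) \<subseteq> {0}" "f ` C \<subseteq> {1}"
    using Urysohn_completely_regular_compact_closed[of 0 1 X C "topspace X - S \<inter> W"]
      assms(3,5) W(4) by (auto simp: disjnt_iff)
  have "X closure_of {x \<in> topspace X. f x \<noteq> 0} \<subseteq> L"
    using f(2) W by (intro closure_of_minimal) auto
  then have "compactin X (X closure_of {x \<in> topspace X. f x \<noteq> 0})"
    using W(2) closed_compactin closedin_closure_of by blast
  with f show thesis
    by (intro that) (auto simp: continuous_map_in_subtopology Pi_iff)
qed

text \<open>The function is dominated by the indicator of its support. That set is closed, hence
  Borel, and compact, hence of finite measure.\<close>

lemma integrable_compact_support: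
  fixes f :: "'a \<Rightarrow> real"
  assumes M: "radon_measure X M" and f: "continuous_map X euclideanreal f"
    and bound: "\<And>x. x \<in> topspace X \<Longrightarrow> 0 \<le> f x \<and> f x \<le> 1"
    and supp: "compactin X (X closure_of {x \<in> topspace X. f x \<noteq> 0})"
  shows "integrable M f"
proof (rule Bochner_Integration.integrable_bound)
  let ?C = "X closure_of {x \<in> topspace X. f x \<noteq> 0}"
  have "?C \<in> sets M"
    using M by (simp add: radon_measure_def closedin_borel_of)
  then show "integrable M (indicat_real ?C)"
    using M supp by (auto simp: radon_measure_def)
  show "f \<in> borel_measurable M"
    using f M by (auto simp: radon_measure_def intro: continuous_map_borel_measurable)
  show "AE x in M. norm (f x) \<le> norm (indicat_real ?C x)"
  proof (rule AE_I2)
    fix x assume "x \<in> space M"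
    then have x: "x \<in> topspace X"
      using M by (simp add: radon_measure_def)
    have "x \<in> ?C" if "f x \<noteq> 0"
      using that x closure_of_subset[of "{x \<in> topspace X. f x \<noteq> 0}" X] by auto
    then show "norm (f x) \<le> norm (indicat_real ?C x)"
      using bound[OF x] by (cases "f x = 0") auto
  qed
qed

text \<open>Urysohn functions give equality on open sets.  Equality on all Borel sets follows by outer
  regularity, since \<open>p\<close> is closed: every open set containing a fibre-saturated set \<open>p -` A\<close>
  contains an open set of the form \<open>p -` W\<close> with \<open>A \<subseteq> W\<close>.\<close>

lemma radon_measure_eq_distr:
  assumes p: "perfect_map X Y p"
    and Y: "locally_compact_space Y" "regular_space Y"
    and M: "radon_measure X M" and N: "radon_measure Y N"
    and eq: "\<And>h::_ \<Rightarrow> real. continuous_map Y euclideanreal h \<Longrightarrow>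
      compactin Y (Y closure_of {y \<in> topspace Y. h y \<noteq> 0}) \<Longrightarrow>
      (LINT x|M. h (p x)) = (LINT y|N. h y)"
  shows "N = distr M N p"
proof -
  note spM = M[unfolded radon_measure_def, THEN conjunct1]
    and seM = M[unfolded radon_measure_def, THEN conjunct2, THEN conjunct1]
    and spN = N[unfolded radon_measure_def, THEN conjunct1]
    and seN = N[unfolded radon_measure_def, THEN conjunct2, THEN conjunct1]
  have cont: "continuous_map X Y p" and proper: "proper_map X Y p"
    and surj: "p ` topspace X = topspace Y"
    using p by (auto simp: perfect_map_def)
  have pY: "p x \<in> topspace Y" if "x \<in> topspace X" for x
    using surj that by blast
  have meas [measurable]: "p \<in> measurable M N"
    using continuous_map_measurable[OF cont spM seM spN seN] .
  \<comment> \<open>The hypothesis \<open>eq\<close> compares Bochner integrals, which are 0 for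
    non-integrable functions, so integrability on both sides comes first. On \<open>X\<close> it
    holds because the proper map \<open>p\<close> pulls the compact support of \<open>h\<close> back
    to a compact set.\<close>
  have integral_eq: "(\<integral>\<^sup>+x. ennreal (h (p x)) \<partial>M) = (\<integral>\<^sup>+y. ennreal (h y) \<partial>N)"
    if h: "continuous_map Y euclideanreal h" "\<And>y. y \<in> topspace Y \<Longrightarrow> 0 \<le> h y \<and> h y \<le> 1"
      "compactin Y (Y closure_of {y \<in> topspace Y. h y \<noteq> 0})" for h :: "_ \<Rightarrow> real"
  proof -
    have intN: "integrable N h"
      by (rule integrable_compact_support[OF N h])
    have hp: "continuous_map X euclideanreal (\<lambda>x. h (p x))"
      using continuous_map_compose[OF cont h(1)] by (simp add: o_def)
    let ?L = "{x \<in> topspace X. p x \<in> Y closure_of {y \<in> topspace Y. h y \<noteq> 0}}"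
    have "compactin X ?L"
      by (rule compactin_proper_map_preimage[OF proper h(3)])
    moreover have "X closure_of {x \<in> topspace X. h (p x) \<noteq> 0} \<subseteq> ?L"
    proof (rule closure_of_minimal)
      show "closedin X ?L"
        by (rule closedin_continuous_map_preimage[OF cont]) simp
      show "{x \<in> topspace X. h (p x) \<noteq> 0} \<subseteq> ?L"
        using pY closure_of_subset[of "{y \<in> topspace Y. h y \<noteq> 0}" Y] by auto
    qed
    ultimately have "compactin X (X closure_of {x \<in> topspace X. h (p x) \<noteq> 0})"
      using closed_compactin closedin_closure_of by blast
    then have intM: "integrable M (\<lambda>x. h (p x))"
      using pY h(2) by (intro integrable_compact_support[OF M hp]) auto
    have "AE x in M. 0 \<le> h (p x)" "AE y in N. 0 \<le> h y"
      using h(2) pY spM spN by (auto intro!: AE_I2)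
    then show ?thesis
      using nn_integral_eq_integral[OF intN] nn_integral_eq_integral[OF intM] eq[OF h(1,3)]
      by simp
  qed
  have open_eq: "emeasure M {x \<in> topspace X. p x \<in> S} = emeasure N S" if S: "openin Y S" for S
  proof (rule antisym)
    let ?S = "{x \<in> topspace X. p x \<in> S}"
    have oS: "openin X ?S"
      by (rule openin_continuous_map_preimage[OF cont S])
    then have SM: "?S \<in> sets M" and SN: "S \<in> sets N"
      using S seM seN by (auto simp: openin_borel_of)
    \<comment> \<open>Inner regularity reduces to compact \<open>C\<close> inside the preimage of
      \<open>S\<close>. A Urysohn function \<open>h\<close> for the compact image of
      \<open>C\<close> inside \<open>S\<close> satisfies 1_C \<le> h o p and h \<le> 1_S, and
      \<open>integral_eq\<close> joins the two bounds.\<close>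
    have "emeasure M ?S = (SUP C\<in>{C. compactin X C \<and> C \<in> sets M \<and> C \<subseteq> ?S}. emeasure M C)"
      using M oS by (auto simp: radon_measure_def)
    also have "\<dots> \<le> emeasure N S"
    proof (rule SUP_least, safe)
      fix C assume C: "compactin X C" "C \<in> sets M" "C \<subseteq> ?S"
      have "compactin Y (p ` C)"
        by (rule image_compactin[OF C(1) cont])
      then obtain h where h: "continuous_map Y euclideanreal h"
          "\<And>y. y \<in> topspace Y \<Longrightarrow> 0 \<le> h y \<and> h y \<le> 1"
          "\<And>y. y \<in> p ` C \<Longrightarrow> h y = 1" "\<And>y. y \<in> topspace Y - S \<Longrightarrow> h y = 0"
          "compactin Y (Y closure_of {y \<in> topspace Y. h y \<noteq> 0})"
        using Urysohn_compact_support[OF Y _ S, of "p ` C"] C(3) by blast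
      have "emeasure M C = (\<integral>\<^sup>+x. indicator C x \<partial>M)"
        using C(2) by simp
      also have "\<dots> \<le> (\<integral>\<^sup>+x. ennreal (h (p x)) \<partial>M)"
        using h(3) by (intro nn_integral_mono) (auto simp: indicator_def)
      also have "\<dots> = (\<integral>\<^sup>+y. ennreal (h y) \<partial>N)"
        by (rule integral_eq[OF h(1,2,5)])
      also have "\<dots> \<le> (\<integral>\<^sup>+y. indicator S y \<partial>N)"
        using h(2,4) spN by (intro nn_integral_mono) (auto simp: indicator_def)
      finally show "emeasure M C \<le> emeasure N S"
        using SN by simp
    qed
    finally show "emeasure M ?S \<le> emeasure N S" .
    \<comment> \<open>The reverse bound takes a compact \<open>C\<close> in \<open>Y\<close> itself,
      with 1_C \<le> h on \<open>Y\<close> and h o p bounded by the indicator of \<open>?S\<close>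
      on \<open>X\<close>.\<close>
    have "emeasure N S = (SUP C\<in>{C. compactin Y C \<and> C \<in> sets N \<and> C \<subseteq> S}. emeasure N C)"
      using N S by (auto simp: radon_measure_def)
    also have "\<dots> \<le> emeasure M ?S"
    proof (rule SUP_least, safe)
      fix C assume C: "compactin Y C" "C \<in> sets N" "C \<subseteq> S"
      obtain h where h: "continuous_map Y euclideanreal h"
          "\<And>y. y \<in> topspace Y \<Longrightarrow> 0 \<le> h y \<and> h y \<le> 1"
          "\<And>y. y \<in> C \<Longrightarrow> h y = 1" "\<And>y. y \<in> topspace Y - S \<Longrightarrow> h y = 0"
          "compactin Y (Y closure_of {y \<in> topspace Y. h y \<noteq> 0})"
        using Urysohn_compact_support[OF Y C(1) S C(3)] by blast
      have "emeasure N C = (\<integral>\<^sup>+y. indicator C y \<partial>N)"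
        using C(2) by simp
      also have "\<dots> \<le> (\<integral>\<^sup>+y. ennreal (h y) \<partial>N)"
        using h(3) by (intro nn_integral_mono) (auto simp: indicator_def)
      also have "\<dots> = (\<integral>\<^sup>+x. ennreal (h (p x)) \<partial>M)"
        by (rule integral_eq[OF h(1,2,5), symmetric])
      also have "\<dots> \<le> (\<integral>\<^sup>+x. indicator ?S x \<partial>M)"
        using h(2,4) pY spM by (intro nn_integral_mono) (auto simp: indicator_def)
      finally show "emeasure N C \<le> emeasure M ?S"
        using SM by simp
    qed
    finally show "emeasure N S \<le> emeasure M ?S" .
  qed
  show ?thesis
  proof (rule measure_eqI)
    fix A assume A: "A \<in> sets N"
    have AY: "A \<subseteq> topspace Y"
      using sets.sets_into_space[OF A] spN by simp
    let ?A = "p -` A \<inter> space M"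
    have AM: "?A \<in> sets M"
      using A by measurable
    have A_eq: "?A = {x \<in> topspace X. p x \<in> A}"
      using spM by auto
    have "emeasure M ?A = emeasure N A"
    proof (rule antisym)
      have "emeasure N A = (INF W\<in>{W. openin Y W \<and> A \<subseteq> W}. emeasure N W)"
        using N A by (auto simp: radon_measure_def)
      moreover have "emeasure M ?A \<le> emeasure N W" if "openin Y W" "A \<subseteq> W" for W
      proof -
        have "{x \<in> topspace X. p x \<in> W} \<in> sets M"
          using openin_continuous_map_preimage[OF cont that(1)] seM by (simp add: openin_borel_of)
        then have "emeasure M ?A \<le> emeasure M {x \<in> topspace X. p x \<in> W}"
          using that(2) spM by (intro emeasure_mono) auto
        then show ?thesis
          using open_eq[OF that(1)] by simp
      qed
      ultimately show "emeasure M ?A \<le> emeasure N A"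
        by (auto intro!: INF_greatest)
      have "emeasure M ?A = (INF W\<in>{W. openin X W \<and> ?A \<subseteq> W}. emeasure M W)"
        using M AM by (auto simp: radon_measure_def)
      moreover have "emeasure N A \<le> emeasure M W" if W: "openin X W" "?A \<subseteq> W" for W
      proof -
        \<comment> \<open>The points of \<open>Y\<close> whose whole fibre lies in \<open>W\<close>:
          the preimage of \<open>?S\<close> is contained in \<open>W\<close>, and \<open>A\<close>
          lies in \<open>?S\<close> because every fibre over \<open>A\<close> is part of
          \<open>?A\<close>.\<close>
        let ?S = "topspace Y - p ` (topspace X - W)"
        have "closedin Y (p ` (topspace X - W))"
          using perfect_imp_closed_map[OF p] W(1) by (auto simp: closed_map_def)
        then have S: "openin Y ?S"
          by blast
        have "A \<subseteq> ?S"
          using AY W(2) spM by auto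
        then have "emeasure N A \<le> emeasure N ?S"
          using S seN by (intro emeasure_mono) (auto simp: openin_borel_of)
        also have "\<dots> = emeasure M {x \<in> topspace X. p x \<in> ?S}"
          by (rule open_eq[OF S, symmetric])
        also have "\<dots> \<le> emeasure M W"
          using W(1) seM by (intro emeasure_mono) (auto simp: openin_borel_of)
        finally show ?thesis .
      qed
      ultimately show "emeasure N A \<le> emeasure M ?A"
        by (auto intro!: INF_greatest)
    qed
    then show "emeasure N A = emeasure (distr M N p) A"
      using A by (simp add: emeasure_distr)
  qed simp
qed


section \<open>The coset space of a compact subgroup\<close>

lemma (in group) l_coset_eq_iff:
  assumes K: "subgroup K G" and "x \<in> carrier G" "y \<in> carrier G"
  shows "x <#\<^bsub>G\<^esub> K = y <#\<^bsub>G\<^esub> K \<longleftrightarrow> inv x \<otimes> y \<in> K"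
  using assms lcos_self l_repr_independence subgroup.lcos_module_imp[OF K is_group]
    subgroup.lcos_module_rev[OF K is_group] by metis

lemma (in group) l_coset_mult_right:
  assumes "subgroup K G" "x \<in> carrier G" "k \<in> K"
  shows "(x \<otimes> k) <#\<^bsub>G\<^esub> K = x <#\<^bsub>G\<^esub> K"
  using assms l_repr_independence[of "x \<otimes> k" x K] by (auto simp: l_coset_def)

text \<open>Controls the representatives picked by \<open>SOME\<close>, both in the inner integral
  of Weil's formula and in the kernel built from a bi-invariant function: the choice costs only a
  right factor in \<open>K\<close>.\<close>

lemma (in group) some_in_l_coset:
  assumes K: "subgroup K G" and x: "x \<in> carrier G"
  obtains k where "k \<in> K" "(SOME g. g \<in> x <#\<^bsub>G\<^esub> K) = x \<otimes> k"
proof -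
  have "(SOME g. g \<in> x <#\<^bsub>G\<^esub> K) \<in> x <#\<^bsub>G\<^esub> K"
    using lcos_self[OF x K] by (rule someI)
  then show thesis
    using that by (auto simp: l_coset_def)
qed

section \<open>Topology of the projection, and translation invariance on the group\<close>

context topological_group
begin

lemma continuous_map_mult:
  assumes "continuous_map X T f" "continuous_map X T g"
  shows "continuous_map X T (\<lambda>x. f x \<otimes> g x)"
proof -
  have "continuous_map X (prod_topology T T) (\<lambda>x. (f x, g x))"
    using assms by (simp add: continuous_map_paired)
  from continuous_map_compose[OF this continuous_mult] show ?thesis
    by (simp add: o_def)
qed

lemma continuous_map_inverse:
  assumes "continuous_map X T f"
  shows "continuous_map X T (\<lambda>x. inv (f x))"
  using continuous_map_compose[OF assms continuous_inv] by (simp add: o_def)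

lemma continuous_map_translation:
  assumes "a \<in> carrier G"
  shows "continuous_map T T (\<lambda>g. a \<otimes> g)"
  using assms by (intro continuous_map_mult) (auto simp: topspace_eq)

text \<open>The saturation CK of a closed set C is the projection to G of the closed set of pairs
  (g, k) in G \<times> K with g k^-1 in C. Projection along a compact factor is closed, so CK is
  closed, which is closedness of the image in the quotient topology. The fibres are translates aK,
  hence compact.\<close>

lemma perfect_map_coset_topology:
  assumes K: "subgroup K G" and comp: "compactin T K"
  shows "perfect_map T (coset_topology G T K) (\<lambda>g. g <#\<^bsub>G\<^esub> K)"
proof -
  let ?p = "\<lambda>g. g <#\<^bsub>G\<^esub> K"
  have KG: "K \<subseteq> carrier G"
    using K by (rule subgroup.subset)
  have q: "quotient_map T (coset_topology G T K) ?p"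
    by (rule quotient_map_coset_topology)
  have "closed_map T (coset_topology G T K) ?p"
    unfolding closed_map_def
  proof (intro allI impI)
    fix C assume C: "closedin T C"
    have CG: "C \<subseteq> carrier G"
      using closedin_subset[OF C] by (simp add: topspace_eq)
    let ?T = "prod_topology T (subtopology T K)"
    let ?D = "{z \<in> topspace ?T. fst z \<otimes> inv (snd z) \<in> C}"
    have "continuous_map ?T T snd"
      by (metis continuous_map_into_fulltopology continuous_map_snd)
    then have "continuous_map ?T T (\<lambda>z. fst z \<otimes> inv (snd z))"
      by (intro continuous_map_mult continuous_map_inverse continuous_map_fst)
    then have "closedin ?T ?D"
      using C by (rule closedin_continuous_map_preimage)
    moreover have "compact_space (subtopology T K)"
      using comp by (simp add: compact_space_subtopology)
    ultimately have "closedin T (fst ` ?D)"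
      using closed_map_fst by (auto simp: closed_map_def)
    moreover have "fst ` ?D = {g \<in> topspace T. g <#\<^bsub>G\<^esub> K \<in> ?p ` C}"
    proof (intro equalityI subsetI)
      fix g assume "g \<in> fst ` ?D"
      then obtain k where k: "g \<in> carrier G" "k \<in> K" "g \<otimes> inv k \<in> C"
        by (auto simp: topspace_eq)
      then have "(g \<otimes> inv k) <#\<^bsub>G\<^esub> K = g <#\<^bsub>G\<^esub> K"
        using subgroup.m_inv_closed[OF K] by (intro l_coset_mult_right[OF K]) auto
      with k show "g \<in> {g \<in> topspace T. g <#\<^bsub>G\<^esub> K \<in> ?p ` C}"
        by (auto simp: topspace_eq intro: rev_image_eqI)
    next
      fix g assume "g \<in> {g \<in> topspace T. g <#\<^bsub>G\<^esub> K \<in> ?p ` C}"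
      then obtain c where c: "g \<in> carrier G" "c \<in> C" "c <#\<^bsub>G\<^esub> K = g <#\<^bsub>G\<^esub> K"
        by (auto simp: topspace_eq)
      \<comment> \<open>The second coordinate solves g k^-1 = c, that is k = c^-1 g.\<close>
      then have "inv c \<otimes> g \<in> K"
        using CG l_coset_eq_iff[OF K, of c g] by auto
      moreover have "g \<otimes> inv (inv c \<otimes> g) = c"
        using c CG by (auto simp: inv_mult_group m_assoc[symmetric])
      ultimately have "(g, inv c \<otimes> g) \<in> ?D"
        using c KG by (auto simp: topspace_eq)
      then show "g \<in> fst ` ?D"
        by (rule image_eqI[rotated]) simp
    qed
    ultimately have "closedin T {g \<in> topspace T. ?p g \<in> ?p ` C}"
      by simp
    moreover have "?p ` C \<subseteq> topspace (coset_topology G T K)"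
      using CG by (auto simp: topspace_coset_topology LCOSETS_def)
    ultimately show "closedin (coset_topology G T K) (?p ` C)"
      using q unfolding quotient_map_closedin by blast
  qed
  moreover have "compactin T {x \<in> topspace T. x <#\<^bsub>G\<^esub> K = X}"
    if X: "X \<in> topspace (coset_topology G T K)" for X
  proof -
    obtain a where a: "a \<in> carrier G" "X = a <#\<^bsub>G\<^esub> K"
      using X by (auto simp: topspace_coset_topology LCOSETS_def)
    have "{x \<in> topspace T. x <#\<^bsub>G\<^esub> K = X} = (\<lambda>k. a \<otimes> k) ` K"
    proof (intro equalityI subsetI)
      fix x assume "x \<in> {x \<in> topspace T. x <#\<^bsub>G\<^esub> K = X}"
      then have x: "x \<in> carrier G" "a <#\<^bsub>G\<^esub> K = x <#\<^bsub>G\<^esub> K"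
        using a by (auto simp: topspace_eq)
      then show "x \<in> (\<lambda>k. a \<otimes> k) ` K"
        using lcos_self[OF x(1) K] by (auto simp: l_coset_def)
    next
      fix x assume "x \<in> (\<lambda>k. a \<otimes> k) ` K"
      then have "x \<in> a <#\<^bsub>G\<^esub> K"
        by (auto simp: l_coset_def)
      then show "x \<in> {x \<in> topspace T. x <#\<^bsub>G\<^esub> K = X}"
        using a K l_repr_independence[of x a K] l_coset_carrier[of x a K]
        by (auto simp: topspace_eq)
    qed
    then show ?thesis
      using image_compactin[OF comp continuous_map_translation[OF a(1)]] by simp
  qed
  ultimately show ?thesis
    using quotient_imp_continuous_map[OF q] quotient_imp_surjective_map[OF q]
    by (auto simp: perfect_map_def proper_map_def)
qed

text \<open>The saturation of an open \<open>W\<close> is the union over k in \<open>K\<close> of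
  the translates W k^-1, each open as the preimage of \<open>W\<close> under right multiplication by
  k. Openness is what carries local compactness down to the coset space.\<close>

lemma open_map_coset_topology:
  assumes K: "subgroup K G"
  shows "open_map T (coset_topology G T K) (\<lambda>g. g <#\<^bsub>G\<^esub> K)"
  unfolding open_map_def
proof (intro allI impI)
  fix W assume W: "openin T W"
  have WG: "W \<subseteq> carrier G"
    using openin_subset[OF W] by (simp add: topspace_eq)
  have KG: "K \<subseteq> carrier G"
    using K by (rule subgroup.subset)
  have "{g \<in> topspace T. g <#\<^bsub>G\<^esub> K \<in> (\<lambda>g. g <#\<^bsub>G\<^esub> K) ` W} = (\<Union>k\<in>K. {g \<in> topspace T. g \<otimes> k \<in> W})"
  proof (intro equalityI subsetI)
    fix g assume "g \<in> {g \<in> topspace T. g <#\<^bsub>G\<^esub> K \<in> (\<lambda>g. g <#\<^bsub>G\<^esub> K) ` W}"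
    then obtain w where w: "g \<in> carrier G" "w \<in> W" "g <#\<^bsub>G\<^esub> K = w <#\<^bsub>G\<^esub> K"
      by (auto simp: topspace_eq)
    then have "w \<in> g <#\<^bsub>G\<^esub> K"
      using WG lcos_self[OF _ K, of w] by auto
    then show "g \<in> (\<Union>k\<in>K. {g \<in> topspace T. g \<otimes> k \<in> W})"
      using w by (auto simp: topspace_eq l_coset_def)
  next
    fix g assume "g \<in> (\<Union>k\<in>K. {g \<in> topspace T. g \<otimes> k \<in> W})"
    then obtain k where k: "g \<in> carrier G" "k \<in> K" "g \<otimes> k \<in> W"
      by (auto simp: topspace_eq)
    then have "g <#\<^bsub>G\<^esub> K = (g \<otimes> k) <#\<^bsub>G\<^esub> K"
      using l_coset_mult_right[OF K] by simp
    with k show "g \<in> {g \<in> topspace T. g <#\<^bsub>G\<^esub> K \<in> (\<lambda>g. g <#\<^bsub>G\<^esub> K) ` W}"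
      by (auto simp: topspace_eq)
  qed
  moreover have "openin T {g \<in> topspace T. g \<otimes> k \<in> W}" if "k \<in> K" for k
    using that KG W
    by (intro openin_continuous_map_preimage[where Y = T] continuous_map_mult)
      (auto simp: topspace_eq)
  ultimately show "openin (coset_topology G T K) ((\<lambda>g. g <#\<^bsub>G\<^esub> K) ` W)"
    using WG by (auto simp: openin_coset_topology LCOSETS_def)
qed

text \<open>A product of quotient maps need not be a quotient map, but a product of proper maps is
  proper. The product projection is therefore perfect, hence a quotient map, and continuity can be
  tested on G \<times> G.\<close>

lemma continuous_map_coset_prod:
  assumes K: "subgroup K G" and comp: "compactin T K"
    and "continuous_map (prod_topology T T) Z (\<lambda>(x, y). f (x <#\<^bsub>G\<^esub> K) (y <#\<^bsub>G\<^esub> K))"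
  shows "continuous_map (prod_topology (coset_topology G T K) (coset_topology G T K)) Z
    (\<lambda>(X, Y). f X Y)"
proof (rule continuous_compose_quotient_map)
  let ?Q = "coset_topology G T K"
  let ?p = "\<lambda>(x, y). (x <#\<^bsub>G\<^esub> K, y <#\<^bsub>G\<^esub> K)"
  note p = perfect_map_coset_topology[OF K comp]
  have "continuous_map (prod_topology T T) (prod_topology ?Q ?Q) ?p"
    using continuous_map_compose[OF continuous_map_fst perfect_imp_continuous_map[OF p], of T]
      continuous_map_compose[OF continuous_map_snd perfect_imp_continuous_map[OF p], of T]
    by (simp add: case_prod_unfold continuous_map_paired o_def)
  moreover have "proper_map (prod_topology T T) (prod_topology ?Q ?Q) ?p"
    using perfect_imp_proper_map[OF p] by (subst proper_map_prod) simp
  moreover have "?p ` topspace (prod_topology T T) = topspace (prod_topology ?Q ?Q)"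
    using perfect_imp_surjective_map[OF p] by (simp add: image_paired_Times)
  ultimately show "quotient_map (prod_topology T T) (prod_topology ?Q ?Q) ?p"
    by (intro perfect_imp_quotient_map) (simp add: perfect_map_def)
  show "continuous_map (prod_topology T T) Z ((\<lambda>(X, Y). f X Y) \<circ> ?p)"
    using assms(3) by (simp add: o_def case_prod_unfold)
qed

text \<open>Left translation by \<open>a\<close> preserves \<open>M\<close>: the preimage of
  \<open>A\<close> is the translate of \<open>A\<close> by \<open>inv a\<close>, which has the same
  measure. Nonnegative integrals are used so that infinite values are covered.\<close>

lemma nn_integral_left_translation:
  assumes M: "left_haar_measure G T M" and a: "a \<in> carrier G" and f: "f \<in> borel_measurable M"
  shows "(\<integral>\<^sup>+g. f (a \<otimes> g) \<partial>M) = (\<integral>\<^sup>+g. f g \<partial>M)"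
proof -
  have sp: "space M = topspace T" "sets M = sets (borel_of T)"
    using M by (auto simp: left_haar_measure_def radon_measure_def)
  have meas: "(\<lambda>g. a \<otimes> g) \<in> measurable M M"
    by (rule continuous_map_measurable[OF continuous_map_translation[OF a] sp sp])
  have "distr M M (\<lambda>g. a \<otimes> g) = M"
  proof (rule measure_eqI)
    fix A assume "A \<in> sets (distr M M (\<lambda>g. a \<otimes> g))"
    then have A: "A \<in> sets M"
      by simp
    then have AG: "A \<subseteq> carrier G"
      using sets.sets_into_space sp by (fastforce simp: topspace_eq)
    have "(\<lambda>g. a \<otimes> g) -` A \<inter> space M = inv a <#\<^bsub>G\<^esub> A"
    proof (intro equalityI subsetI)
      fix g assume "g \<in> (\<lambda>g. a \<otimes> g) -` A \<inter> space M"
      then have "g \<in> carrier G" "a \<otimes> g \<in> A"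
        using sp by (auto simp: topspace_eq)
      moreover from this have "g = inv a \<otimes> (a \<otimes> g)"
        using a by (simp add: m_assoc[symmetric])
      ultimately show "g \<in> inv a <#\<^bsub>G\<^esub> A"
        unfolding l_coset_def by blast
    next
      fix g assume "g \<in> inv a <#\<^bsub>G\<^esub> A"
      then obtain b where "b \<in> A" "g = inv a \<otimes> b"
        by (auto simp: l_coset_def)
      moreover from this have "a \<otimes> g = b"
        using a AG by (auto simp: m_assoc[symmetric])
      ultimately show "g \<in> (\<lambda>g. a \<otimes> g) -` A \<inter> space M"
        using a AG sp by (auto simp: topspace_eq)
    qed
    then show "emeasure (distr M M (\<lambda>g. a \<otimes> g)) A = emeasure M A"
      using M A a meas by (simp add: emeasure_distr left_haar_measure_def)
  qed simp
  then show ?thesis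
    using nn_integral_distr[OF meas, of f] f by simp
qed

end

text \<open>Weil's formula is applied to \<open>h\<close> composed with the projection, which is
  compactly supported because the projection is proper. As this function is constant on cosets, the
  inner integral collapses to \<open>h\<close>, giving the hypothesis of
  \<open>radon_measure_eq_distr\<close>.\<close>

lemma (in locally_compact_group) invariant_coset_measure_eq_distr:
  assumes K: "subgroup K G" and comp: "compactin T K"
    and G: "left_haar_measure G T \<nu>\<^sub>G" and nK: "normalized_haar_measure G T K \<nu>\<^sub>K"
    and \<mu>: "invariant_coset_measure G T K \<nu>\<^sub>G \<nu>\<^sub>K \<mu>"
  shows "\<mu> = distr \<nu>\<^sub>G \<mu> (\<lambda>g. g <#\<^bsub>G\<^esub> K)"
proof (rule radon_measure_eq_distr)
  let ?Q = "coset_topology G T K"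
  show p: "perfect_map T ?Q (\<lambda>g. g <#\<^bsub>G\<^esub> K)"
    by (rule perfect_map_coset_topology[OF K comp])
  show "locally_compact_space ?Q"
    using locally_compact_space_continuous_open_map_image[OF perfect_imp_continuous_map[OF p]
        open_map_coset_topology[OF K] perfect_imp_surjective_map[OF p] locally_compact] .
  \<comment> \<open>\<open>T\<close> is regular, being Hausdorff and locally compact, and regularity
    passes to images under perfect maps.\<close>
  show "regular_space ?Q"
    using regular_space_perfect_map_image p Hausdorff locally_compact
      locally_compact_Hausdorff_imp_regular_space by blast
  show "radon_measure T \<nu>\<^sub>G"
    using G by (simp add: left_haar_measure_def)
  show R: "radon_measure ?Q \<mu>"
    using \<mu> by (simp add: invariant_coset_measure_def)
  have KG: "K \<subseteq> carrier G"
    using K by (rule subgroup.subset)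
  have spK: "space \<nu>\<^sub>K = K" "emeasure \<nu>\<^sub>K K = 1"
    using nK KG by (auto simp: normalized_haar_measure_def left_haar_measure_def
        radon_measure_def topspace_eq)
  fix h :: "'a set \<Rightarrow> real"
  assume h: "continuous_map ?Q euclideanreal h"
    "compactin ?Q (?Q closure_of {y \<in> topspace ?Q. h y \<noteq> 0})"
  \<comment> \<open>\<open>Cc\<close> consists of complex-valued functions, so the real
    \<open>h\<close> is embedded; the coercion is pulled out of both integrals at the end.\<close>
  let ?f = "\<lambda>g. complex_of_real (h (g <#\<^bsub>G\<^esub> K))"
  have cont: "continuous_map T euclidean ?f"
    using continuous_map_compose[OF
        continuous_map_compose[OF perfect_imp_continuous_map[OF p] h(1)],
        of euclidean complex_of_real]
    by (simp add: o_def continuous_on_of_real)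
  let ?L = "{x \<in> topspace T. x <#\<^bsub>G\<^esub> K \<in> ?Q closure_of {y \<in> topspace ?Q. h y \<noteq> 0}}"
  have "compactin T ?L"
    by (rule compactin_proper_map_preimage[OF perfect_imp_proper_map[OF p] h(2)])
  moreover have "T closure_of {x \<in> topspace T. ?f x \<noteq> 0} \<subseteq> ?L"
  proof (rule closure_of_minimal)
    show "closedin T ?L"
      by (rule closedin_continuous_map_preimage[OF perfect_imp_continuous_map[OF p]]) simp
    show "{x \<in> topspace T. ?f x \<noteq> 0} \<subseteq> ?L"
      using perfect_imp_surjective_map[OF p]
        closure_of_subset[of "{y \<in> topspace ?Q. h y \<noteq> 0}" ?Q] by auto
  qed
  ultimately have "compactin T (T closure_of {x \<in> topspace T. ?f x \<noteq> 0})"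
    using closed_compactin closedin_closure_of by blast
  with cont have "?f \<in> Cc T"
    by (simp add: Cc_def)
  then have "(LINT g|\<nu>\<^sub>G. ?f g) = (LINT X|\<mu>. (LINT k|\<nu>\<^sub>K. ?f ((SOME g. g \<in> X) \<otimes> k)))"
    using \<mu> unfolding invariant_coset_measure_def by blast
  also have "\<dots> = (LINT X|\<mu>. complex_of_real (h X))"
  proof (rule Bochner_Integration.integral_cong[OF refl])
    fix X assume "X \<in> space \<mu>"
    then obtain a where a: "a \<in> carrier G" "X = a <#\<^bsub>G\<^esub> K"
      using R by (auto simp: radon_measure_def topspace_coset_topology LCOSETS_def)
    obtain k\<^sub>0 where k\<^sub>0: "k\<^sub>0 \<in> K" "(SOME g. g \<in> X) = a \<otimes> k\<^sub>0"
      using some_in_l_coset[OF K a(1)] a(2) by metis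
    \<comment> \<open>Right multiplication by \<open>K\<close> stays in the coset, so the inner
      integrand is the constant \<open>h X\<close>, and its integral is \<open>h X\<close> since
      \<open>\<nu>\<^sub>K\<close> has total mass 1.\<close>
    have "((SOME g. g \<in> X) \<otimes> k) <#\<^bsub>G\<^esub> K = X" if "k \<in> K" for k
    proof -
      have "k\<^sub>0 \<in> carrier G"
        using k\<^sub>0 KG by blast
      then show ?thesis
        using a k\<^sub>0 that l_coset_mult_right[OF K] by simp
    qed
    then have "(LINT k|\<nu>\<^sub>K. ?f ((SOME g. g \<in> X) \<otimes> k)) = (LINT k|\<nu>\<^sub>K. complex_of_real (h X))"
      using spK by (intro Bochner_Integration.integral_cong) auto
    also have "\<dots> = complex_of_real (h X)"
      using spK by (simp add: measure_def)
    finally show "(LINT k|\<nu>\<^sub>K. ?f ((SOME g. g \<in> X) \<otimes> k)) = complex_of_real (h X)" .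
  qed
  finally show "(LINT x|\<nu>\<^sub>G. h (x <#\<^bsub>G\<^esub> K)) = (LINT y|\<mu>. h y)"
    by simp
qed


section \<open>Invariant kernels and bi-invariant functions\<close>

context topological_group
begin

text \<open>A change of variables along the projection leads to the integral of \<phi>(x^-1 g) over
  G, and left invariance removes x^-1. The function \<open>F\<close> will be \<open>ennreal\<close>
  and \<open>ennreal\<close> after negation, which yields the positive and the negative part from
  one statement.\<close>

lemma nn_integral_invariant_kernel:
  fixes \<Phi> :: "'a set \<Rightarrow> 'a set \<Rightarrow> real"
  assumes K: "subgroup K G" and G: "left_haar_measure G T \<nu>\<^sub>G"
    and \<mu>: "\<mu> = distr \<nu>\<^sub>G \<mu> (\<lambda>g. g <#\<^bsub>G\<^esub> K)" and p: "(\<lambda>g. g <#\<^bsub>G\<^esub> K) \<in> measurable \<nu>\<^sub>G \<mu>"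
    and x: "x \<in> carrier G"
    and \<Phi>: "\<And>g. g \<in> carrier G \<Longrightarrow> \<Phi> (x <#\<^bsub>G\<^esub> K) (g <#\<^bsub>G\<^esub> K) = \<phi> (inv x \<otimes> g)"
    and m: "\<Phi> (x <#\<^bsub>G\<^esub> K) \<in> borel_measurable \<mu>" "\<phi> \<in> borel_measurable \<nu>\<^sub>G"
    and F: "F \<in> borel_measurable borel"
  shows "(\<integral>\<^sup>+X. F (\<Phi> (x <#\<^bsub>G\<^esub> K) X) \<partial>\<mu>) = (\<integral>\<^sup>+g. F (\<phi> g) \<partial>\<nu>\<^sub>G)"
proof -
  have "(\<integral>\<^sup>+X. F (\<Phi> (x <#\<^bsub>G\<^esub> K) X) \<partial>\<mu>) = (\<integral>\<^sup>+g. F (\<Phi> (x <#\<^bsub>G\<^esub> K) (g <#\<^bsub>G\<^esub> K)) \<partial>\<nu>\<^sub>G)"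
    using measurable_compose[OF m(1) F] by (subst \<mu>) (simp add: nn_integral_distr[OF p])
  also have "\<dots> = (\<integral>\<^sup>+g. F (\<phi> (inv x \<otimes> g)) \<partial>\<nu>\<^sub>G)"
    using G \<Phi> by (intro nn_integral_cong)
      (auto simp: left_haar_measure_def radon_measure_def topspace_eq)
  also have "\<dots> = (\<integral>\<^sup>+g. F (\<phi> g) \<partial>\<nu>\<^sub>G)"
    using nn_integral_left_translation[OF G, of "inv x" "\<lambda>g. F (\<phi> g)"] F m(2) x by simp
  finally show ?thesis .
qed

text \<open>Passing from x, y to xk, yl replaces x^-1 y by k^-1 x^-1 y l, which bi-invariance
  absorbs. Hence the kernel defined through chosen representatives can be evaluated at any
  representatives.\<close>

lemma kernel_of_fun:
  assumes K: "subgroup K G" and \<phi>: "bi_invariant_fun G K \<phi>"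
    and x: "x \<in> carrier G" and y: "y \<in> carrier G"
  shows "\<phi> (inv (SOME g. g \<in> x <#\<^bsub>G\<^esub> K) \<otimes> (SOME g. g \<in> y <#\<^bsub>G\<^esub> K)) = \<phi> (inv x \<otimes> y)"
proof -
  obtain k l where k: "k \<in> K" "(SOME g. g \<in> x <#\<^bsub>G\<^esub> K) = x \<otimes> k"
    and l: "l \<in> K" "(SOME g. g \<in> y <#\<^bsub>G\<^esub> K) = y \<otimes> l"
    using some_in_l_coset[OF K x] some_in_l_coset[OF K y] by metis
  have kl: "k \<in> carrier G" "l \<in> carrier G"
    using k l K subgroup.subset by blast+
  have "inv (x \<otimes> k) \<otimes> (y \<otimes> l) = inv k \<otimes> (inv x \<otimes> y) \<otimes> l"
    using x y kl by (simp add: inv_mult_group m_assoc)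
  then show ?thesis
    using \<phi> x y k l subgroup.m_inv_closed[OF K k(1)] by (simp add: bi_invariant_fun_def)
qed

text \<open>Translation by \<open>inv x\<close> moves the first argument to the base coset
  \<open>K\<close>, so an invariant kernel is determined by one function on G.\<close>

lemma invariant_kernel_eq:
  assumes K: "subgroup K G" and \<Phi>: "invariant_kernel G K \<Phi>"
    and x: "x \<in> carrier G" and y: "y \<in> carrier G"
  shows "\<Phi> (x <#\<^bsub>G\<^esub> K) (y <#\<^bsub>G\<^esub> K) = \<Phi> K ((inv x \<otimes> y) <#\<^bsub>G\<^esub> K)"
proof -
  have "\<Phi> ((inv x \<otimes> x) <#\<^bsub>G\<^esub> K) ((inv x \<otimes> y) <#\<^bsub>G\<^esub> K) = \<Phi> (x <#\<^bsub>G\<^esub> K) (y <#\<^bsub>G\<^esub> K)"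
    using \<Phi> x y unfolding invariant_kernel_def by blast
  then show ?thesis
    using x lcos_mult_one[OF subgroup.subset[OF K]] by simp
qed

lemma F_ker_imp_F_fun:
  assumes K: "subgroup K G" and \<Phi>: "\<Phi> \<in> F_ker G T K U V"
  shows "(\<lambda>g. \<Phi> K (g <#\<^bsub>G\<^esub> K)) \<in> F_fun G T K U V"
proof -
  let ?Q = "coset_topology G T K"
  have KG: "K \<subseteq> carrier G"
    using K by (rule subgroup.subset)
  have K1: "\<one> <#\<^bsub>G\<^esub> K = K"
    by (rule lcos_mult_one[OF KG])
  have \<Phi>_cont: "continuous_map (prod_topology ?Q ?Q) euclideanreal (\<lambda>(X, Y). \<Phi> X Y)"
    and pd: "pos_def_kernel G K (\<lambda>X Y. complex_of_real (\<Phi> X Y))"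
    and inv: "invariant_kernel G K \<Phi>"
    and one: "\<Phi> K K = 1"
    and supp: "supp_kernel G T K (\<lambda>X Y. max (\<Phi> X Y) 0) \<subseteq> U"
      "supp_kernel G T K (\<lambda>X Y. max (- \<Phi> X Y) 0) \<subseteq> V"
    using \<Phi> K1 by (auto simp: F_ker_def dest: bspec[of _ _ \<one>])
  have "K \<in> topspace ?Q"
    using K1 by (force simp: topspace_coset_topology LCOSETS_def)
  then have "continuous_map T (prod_topology ?Q ?Q) (\<lambda>g. (K, g <#\<^bsub>G\<^esub> K))"
    using quotient_imp_continuous_map[OF quotient_map_coset_topology]
    by (simp add: continuous_map_paired)
  from continuous_map_compose[OF this \<Phi>_cont]
  have cont: "continuous_map T euclideanreal (\<lambda>g. \<Phi> K (g <#\<^bsub>G\<^esub> K))"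
    by (simp add: o_def)
  have "pos_def_fun G (\<lambda>g. complex_of_real (\<Phi> K (g <#\<^bsub>G\<^esub> K)))"
    unfolding pos_def_fun_def
  proof (intro allI impI)
    fix n :: nat and c g assume g: "\<forall>i<n. g i \<in> carrier G"
    have "(\<Sum>i<n. \<Sum>j<n. complex_of_real (\<Phi> (g i <#\<^bsub>G\<^esub> K) (g j <#\<^bsub>G\<^esub> K)) * c i * cnj (c j)) \<in> \<real>\<^sub>\<ge>\<^sub>0"
      using pd g unfolding pos_def_kernel_def by blast
    also have "(\<Sum>i<n. \<Sum>j<n. complex_of_real (\<Phi> (g i <#\<^bsub>G\<^esub> K) (g j <#\<^bsub>G\<^esub> K)) * c i * cnj (c j)) =
        (\<Sum>i<n. \<Sum>j<n. c i * cnj (c j) * complex_of_real (\<Phi> K ((inv (g i) \<otimes> g j) <#\<^bsub>G\<^esub> K)))"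
      using g by (intro sum.cong refl) (simp add: invariant_kernel_eq[OF K inv])
    finally show "\<dots> \<in> \<real>\<^sub>\<ge>\<^sub>0" .
  qed
  moreover have "bi_invariant_fun G K (\<lambda>g. \<Phi> K (g <#\<^bsub>G\<^esub> K))"
    unfolding bi_invariant_fun_def
  proof (intro ballI)
    fix g k k' assume g: "g \<in> carrier G" and k: "k \<in> K" and k': "k' \<in> K"
    have c: "k \<in> carrier G" "k' \<in> carrier G"
      using k k' KG by auto
    have "(k \<otimes> g \<otimes> k') <#\<^bsub>G\<^esub> K = (k \<otimes> g) <#\<^bsub>G\<^esub> K"
      using g c k' by (intro l_coset_mult_right[OF K]) auto
    \<comment> \<open>An element of \<open>K\<close> fixes the base coset, so invariance of the
      kernel under \<open>k\<close> becomes left \<open>K\<close>-invariance; right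
      \<open>K\<close>-invariance is built into evaluation on cosets.\<close>
    moreover have "(k \<otimes> \<one>) <#\<^bsub>G\<^esub> K = K"
      using c k K coset_join3 by simp
    ultimately show "\<Phi> K ((k \<otimes> g \<otimes> k') <#\<^bsub>G\<^esub> K) = \<Phi> K (g <#\<^bsub>G\<^esub> K)"
      using inv[unfolded invariant_kernel_def, rule_format, OF c(1) one_closed g] K1 by simp
  qed
  ultimately show ?thesis
    using cont one supp K1 by (simp add: F_fun_def supp_def supp_kernel_def topspace_eq)
qed

lemma F_fun_imp_F_ker:
  assumes K: "subgroup K G" and comp: "compactin T K" and \<phi>: "\<phi> \<in> F_fun G T K U V"
  shows "(\<lambda>X Y. \<phi> (inv (SOME g. g \<in> X) \<otimes> (SOME g. g \<in> Y))) \<in> F_ker G T K U V"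
    (is "?\<Phi> \<in> _")
proof -
  have K1: "\<one> <#\<^bsub>G\<^esub> K = K"
    by (rule lcos_mult_one[OF subgroup.subset[OF K]])
  have cont: "continuous_map T euclideanreal \<phi>"
    and pd: "pos_def_fun G (\<lambda>g. complex_of_real (\<phi> g))"
    and bi: "bi_invariant_fun G K \<phi>"
    and one: "\<phi> \<one> = 1"
    and supp: "supp T (\<lambda>g. max (\<phi> g) 0) \<subseteq> U" "supp T (\<lambda>g. max (- \<phi> g) 0) \<subseteq> V"
    using \<phi> by (auto simp: F_fun_def)
  note eq = kernel_of_fun[OF K bi]
  have "continuous_map (prod_topology T T) T (\<lambda>z. inv (fst z) \<otimes> snd z)"
    by (intro continuous_map_mult continuous_map_inverse continuous_map_fst continuous_map_snd)
  \<comment> \<open>The choice of representatives need not be continuous, but pulled back to G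
    \<times> G the kernel is \<phi>(x^-1 y), which is continuous and descends to the cosets.\<close>
  from continuous_map_compose[OF this cont]
  have "continuous_map (prod_topology T T) euclideanreal (\<lambda>(x, y). ?\<Phi> (x <#\<^bsub>G\<^esub> K) (y <#\<^bsub>G\<^esub> K))"
    by (rule continuous_map_eq) (auto simp: eq topspace_eq)
  note \<Phi>_cont = continuous_map_coset_prod[OF K comp this]
  have \<Phi>_pd: "pos_def_kernel G K (\<lambda>X Y. complex_of_real (?\<Phi> X Y))"
    unfolding pos_def_kernel_def
  proof (intro allI impI)
    fix n :: nat and a x assume x: "\<forall>i<n. x i \<in> carrier G"
    have "(\<Sum>i<n. \<Sum>j<n. a i * cnj (a j) * complex_of_real (\<phi> (inv (x i) \<otimes> x j))) \<in> \<real>\<^sub>\<ge>\<^sub>0"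
      using pd x unfolding pos_def_fun_def by blast
    also have "(\<Sum>i<n. \<Sum>j<n. a i * cnj (a j) * complex_of_real (\<phi> (inv (x i) \<otimes> x j))) =
        (\<Sum>i<n. \<Sum>j<n. complex_of_real (?\<Phi> (x i <#\<^bsub>G\<^esub> K) (x j <#\<^bsub>G\<^esub> K)) * a i * cnj (a j))"
      using x by (intro sum.cong refl) (simp add: eq)
    finally show "\<dots> \<in> \<real>\<^sub>\<ge>\<^sub>0" .
  qed
  have \<Phi>_inv: "invariant_kernel G K ?\<Phi>"
    unfolding invariant_kernel_def
  proof (intro ballI)
    fix g x y assume c: "g \<in> carrier G" "x \<in> carrier G" "y \<in> carrier G"
    have "inv g \<otimes> (g \<otimes> y) = y"
      using c by (simp add: m_assoc[symmetric])
    then have "inv (g \<otimes> x) \<otimes> (g \<otimes> y) = inv x \<otimes> y"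
      using c by (simp add: inv_mult_group m_assoc)
    then show "?\<Phi> ((g \<otimes> x) <#\<^bsub>G\<^esub> K) ((g \<otimes> y) <#\<^bsub>G\<^esub> K) = ?\<Phi> (x <#\<^bsub>G\<^esub> K) (y <#\<^bsub>G\<^esub> K)"
      using c by (simp add: eq)
  qed
  \<comment> \<open>Kernel supports are taken at the base coset, where the kernel is
    \<open>\<phi>\<close> itself; the supports therefore agree exactly.\<close>
  have "?\<Phi> (\<one> <#\<^bsub>G\<^esub> K) (x <#\<^bsub>G\<^esub> K) = \<phi> x" if "x \<in> carrier G" for x
    using that by (simp add: eq)
  then have "{x \<in> carrier G. max (?\<Phi> (\<one> <#\<^bsub>G\<^esub> K) (x <#\<^bsub>G\<^esub> K)) 0 \<noteq> 0} = {x \<in> carrier G. max (\<phi> x) 0 \<noteq> 0}"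
    "{x \<in> carrier G. max (- ?\<Phi> (\<one> <#\<^bsub>G\<^esub> K) (x <#\<^bsub>G\<^esub> K)) 0 \<noteq> 0} = {x \<in> carrier G. max (- \<phi> x) 0 \<noteq> 0}"
    by auto
  then have "supp_kernel G T K (\<lambda>X Y. max (?\<Phi> X Y) 0) \<subseteq> U"
    "supp_kernel G T K (\<lambda>X Y. max (- ?\<Phi> X Y) 0) \<subseteq> V"
    using supp by (simp_all only: supp_def supp_kernel_def topspace_eq)
  then show ?thesis
    using \<Phi>_cont \<Phi>_pd \<Phi>_inv one by (simp add: F_ker_def eq)
qed

end

section \<open>Equality of the two suprema\<close>

theorem theorem7:
  fixes G :: "('a, 'b) monoid_scheme" and T :: "'a topology"
    and K U V :: "'a set"
    and \<nu>\<^sub>G \<nu>\<^sub>K :: "'a measure" and \<mu> :: "'a set measure"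
    and x :: 'a
  assumes "locally_compact_group G T"
    and "subgroup K G" and "compactin T K"
    and "left_haar_measure G T \<nu>\<^sub>G"
    and "normalized_haar_measure G T K \<nu>\<^sub>K"
    and "invariant_coset_measure G T K \<nu>\<^sub>G \<nu>\<^sub>K \<mu>"
    and "U \<subseteq> carrier G" and "\<exists>W. openin T W \<and> \<one>\<^bsub>G\<^esub> \<in> W \<and> W \<subseteq> U"
    and "bi_invariant_set G K U" and "symmetric_set G U"
    and "V \<subseteq> carrier G"
    and "bi_invariant_set G K V" and "symmetric_set G V"
    and "x \<in> carrier G"
  shows "C_ker G T K \<mu> x U V = C_fun G T K \<nu>\<^sub>G U V"
proof -
  interpret locally_compact_group G T by fact
  note K = \<open>subgroup K G\<close> and comp = \<open>compactin T K\<close> and G = \<open>left_haar_measure G T \<nu>\<^sub>G\<close>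
    and x = \<open>x \<in> carrier G\<close>
  let ?Q = "coset_topology G T K"
  have sp: "space \<nu>\<^sub>G = topspace T" "sets \<nu>\<^sub>G = sets (borel_of T)"
      "space \<mu> = topspace ?Q" "sets \<mu> = sets (borel_of ?Q)"
    using assms(4,6)
    by (auto simp: left_haar_measure_def invariant_coset_measure_def radon_measure_def)
  have p: "(\<lambda>g. g <#\<^bsub>G\<^esub> K) \<in> measurable \<nu>\<^sub>G \<mu>"
    using quotient_imp_continuous_map[OF quotient_map_coset_topology] sp
    by (rule continuous_map_measurable)
  note \<mu> = invariant_coset_measure_eq_distr[OF K comp G assms(5,6)]
  \<comment> \<open>Stated for any matching pair, so that it serves both inequalities. Positive and
    negative parts are transferred separately, hence existence of the extended integral transfers
    along with its value.\<close>
  have transfer: "has_ext_integral \<mu> (\<Phi> (x <#\<^bsub>G\<^esub> K)) = has_ext_integral \<nu>\<^sub>G \<phi> \<and>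
      ext_integral \<mu> (\<Phi> (x <#\<^bsub>G\<^esub> K)) = ext_integral \<nu>\<^sub>G \<phi>"
    if \<Phi>: "\<Phi> \<in> F_ker G T K U V" and \<phi>: "\<phi> \<in> F_fun G T K U V"
      and eq: "\<And>g. g \<in> carrier G \<Longrightarrow> \<Phi> (x <#\<^bsub>G\<^esub> K) (g <#\<^bsub>G\<^esub> K) = \<phi> (inv\<^bsub>G\<^esub> x \<otimes>\<^bsub>G\<^esub> g)" for \<Phi> \<phi>
  proof -
    have "x <#\<^bsub>G\<^esub> K \<in> topspace ?Q"
      using x by (auto simp: topspace_coset_topology LCOSETS_def)
    then have "continuous_map ?Q (prod_topology ?Q ?Q) (\<lambda>Y. (x <#\<^bsub>G\<^esub> K, Y))"
      by (simp add: continuous_map_paired)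
    moreover have "continuous_map (prod_topology ?Q ?Q) euclideanreal (\<lambda>(X, Y). \<Phi> X Y)"
      using \<Phi> by (simp add: F_ker_def)
    ultimately have "continuous_map ?Q euclideanreal (\<Phi> (x <#\<^bsub>G\<^esub> K))"
      by (auto dest: continuous_map_compose simp: o_def)
    then have m1: "\<Phi> (x <#\<^bsub>G\<^esub> K) \<in> borel_measurable \<mu>"
      using sp by (intro continuous_map_borel_measurable)
    have m2: "\<phi> \<in> borel_measurable \<nu>\<^sub>G"
      using \<phi> sp by (intro continuous_map_borel_measurable) (auto simp: F_fun_def)
    note I = nn_integral_invariant_kernel[where \<Phi> = \<Phi> and \<phi> = \<phi>, OF K G \<mu> p x eq m1 m2]
    show ?thesis
      using I[of ennreal] I[of "\<lambda>t. ennreal (- t)"] m1 m2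
      by (simp add: has_ext_integral_def ext_integral_def)
  qed
  show ?thesis
    unfolding C_ker_def C_fun_def
  \<comment> \<open>Each admissible element on one side has a partner on the other with the same
    extended integral: the restriction of the kernel to the base coset in one direction, the kernel
    of chosen representatives in the other.\<close>
  proof (rule SUP_eq)
    fix \<Phi> assume "\<Phi> \<in> {\<Phi> \<in> F_ker G T K U V. has_ext_integral \<mu> (\<Phi> (x <#\<^bsub>G\<^esub> K))}"
    then have \<Phi>: "\<Phi> \<in> F_ker G T K U V" "has_ext_integral \<mu> (\<Phi> (x <#\<^bsub>G\<^esub> K))"
      by auto
    then have "invariant_kernel G K \<Phi>"
      by (simp add: F_ker_def)
    note transfer[OF \<Phi>(1) F_ker_imp_F_fun[OF K \<Phi>(1)] invariant_kernel_eq[OF K this x]]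
    then show "\<exists>\<phi>\<in>{\<phi> \<in> F_fun G T K U V. has_ext_integral \<nu>\<^sub>G \<phi>}.
        ext_integral \<mu> (\<Phi> (x <#\<^bsub>G\<^esub> K)) \<le> ext_integral \<nu>\<^sub>G \<phi>"
      using \<Phi>(2) F_ker_imp_F_fun[OF K \<Phi>(1)] by (intro bexI) auto
  next
    fix \<phi> assume "\<phi> \<in> {\<phi> \<in> F_fun G T K U V. has_ext_integral \<nu>\<^sub>G \<phi>}"
    then have \<phi>: "\<phi> \<in> F_fun G T K U V" "has_ext_integral \<nu>\<^sub>G \<phi>"
      by auto
    then have "bi_invariant_fun G K \<phi>"
      by (simp add: F_fun_def)
    note transfer[OF F_fun_imp_F_ker[OF K comp \<phi>(1)] \<phi>(1) kernel_of_fun[OF K this x]]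
    then show "\<exists>\<Phi>\<in>{\<Phi> \<in> F_ker G T K U V. has_ext_integral \<mu> (\<Phi> (x <#\<^bsub>G\<^esub> K))}.
        ext_integral \<nu>\<^sub>G \<phi> \<le> ext_integral \<mu> (\<Phi> (x <#\<^bsub>G\<^esub> K))"
      using \<phi>(2) F_fun_imp_F_ker[OF K comp \<phi>(1)] by (intro bexI) auto
  qed
qed

end
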